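(* Let $G$ be a connected graph on $n$ vertices, with neighbor-locating chromatic number $k$ and average degree $d$. Then $n = \mathcal{O}(d^2 k^{\lceil d\rceil+1})$. More precisely: (i) if $k \le \lceil d\rceil$, then $n < \lceil d\rceil k^{\lceil d\rceil-1}$; (ii) if $k \ge \lceil d\rceil+1$, then $n \le k\sum_{i=1}^{\lceil d\rceil}(\lceil d\rceil+1-i)\binom{k-1}{i}$. Moreover, any connected graph $G$ with neighbor-locating chromatic number $k \ge \lceil d\rceil+1$ and average degree $d$ whose order attains the upper bound in (ii) has maximum degree $\Delta \le \lceil d\rceil+1$ and exactly $k\binom{k-1}{i}$ vertices of degree $i$ (for $1\le i\le \lceil d\rceil$).
   Context: All graphs are simple. A proper $k$-coloring $f$ of $G$ is neighbor-locating if any two distinct vertices $x,y$ with $f(x)=f(y)$ have different sets of colors appearing in their neighborhoods. The neighbor-locating chromatic number $\chi_{NL}(G)$ is the minimum $k$ admitting such a coloring. The average degree of a graph with $n$ vertices and $m$ edges is $2m/n$.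
   Formalization: The O-bound and (ii) are stated for n ≥ 2, since both fail for the one-vertex graph (n = k = 1, d = 0). The constant in the O-bound is uniform over all graphs on a given vertex and edge type; the natural numbers cover all finite graphs up to isomorphism. *)

theory Defs
  imports Complex_Main "Graph_Theory.Digraph_Component"
begin

text \<open>
  A finite simple graph is a \<^locale>\<open>graph\<close>: a finite digraph without loops and parallel
  arcs whose adjacency relation is symmetric.  Each undirected edge is thus represented by two
  opposite arcs, and the degree of a vertex \<open>v\<close> is \<open>out_degree G v\<close>.
\<close>

definition edges :: "('a, 'b) pre_digraph \<Rightarrow> 'a set set" where
  "edges G = (\<lambda>e. {tail G e, head G e}) ` arcs G"

definition average_degree :: "('a, 'b) pre_digraph \<Rightarrow> real" where
  "average_degree G = 2 * real (card (edges G)) / real (card (verts G))"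

definition max_degree :: "('a, 'b) pre_digraph \<Rightarrow> nat" where
  "max_degree G = Max (out_degree G ` verts G)"

definition neighborhood :: "('a, 'b) pre_digraph \<Rightarrow> 'a \<Rightarrow> 'a set" where
  "neighborhood G v = {w \<in> verts G. v \<rightarrow>\<^bsub>G\<^esub> w}"

definition proper_coloring :: "('a, 'b) pre_digraph \<Rightarrow> nat \<Rightarrow> ('a \<Rightarrow> nat) \<Rightarrow> bool" where
  "proper_coloring G k f \<longleftrightarrow>
     f ` verts G \<subseteq> {1..k} \<and> (\<forall>u\<in>verts G. \<forall>v\<in>verts G. u \<rightarrow>\<^bsub>G\<^esub> v \<longrightarrow> f u \<noteq> f v)"

definition neighbor_locating_coloring :: "('a, 'b) pre_digraph \<Rightarrow> nat \<Rightarrow> ('a \<Rightarrow> nat) \<Rightarrow> bool" where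
  "neighbor_locating_coloring G k f \<longleftrightarrow>
     proper_coloring G k f \<and>
     (\<forall>x\<in>verts G. \<forall>y\<in>verts G. x \<noteq> y \<longrightarrow> f x = f y \<longrightarrow>
        f ` neighborhood G x \<noteq> f ` neighborhood G y)"

text \<open>
  The minimum exists for every finite graph, since an injective coloring is neighbor-locating.
\<close>

definition nl_chromatic_number :: "('a, 'b) pre_digraph \<Rightarrow> nat" where
  "nl_chromatic_number G = (LEAST k. \<exists>f. neighbor_locating_coloring G k f)"

end

theory Submission
  imports Defs
begin

text \<open>
  A neighbor-locating coloring with \<open>k\<close> colors sends vertices injectively to pairs of a color and
  a nonempty set of other colors, of size at most the degree.  Hence at most
  \<open>S\<^sub>i = k (\<Sum>j=1..i. (k - 1) choose j)\<close> vertices have degree at most \<open>i\<close>.  With \<open>D = \<lceil>d\<rceil>\<close>, the degree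
  sum is at most \<open>D n\<close>, so \<open>n \<le> (\<Sum>v. D + 1 - deg v)\<close>.  Dropping the negative terms, this is at most
  \<open>\<Sum>i=1..D. #{v. deg v \<le> i}\<close>, hence at most \<open>\<Sum>i=1..D. S\<^sub>i\<close>, which is the bound in (ii).  In the
  equality case no negative term was dropped and every count equals \<open>S\<^sub>i\<close>.  For \<open>k \<le> D\<close> the pairs
  without a size restriction already give \<open>n \<le> k (2 ^ (k - 1) - 1) < k ^ k\<close>.
\<close>

section \<open>Counting identities for binomial sums and small subsets\<close>

text \<open>On the right, \<open>m choose j\<close> occurs once for each upper limit from
  \<open>j\<close> to \<open>D\<close>, hence \<open>D + 1 - j\<close> times. This turns the
  weighted sum of the bound into a sum of counts over degree thresholds.\<close>

lemma sum_binomial_tail: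
  "(\<Sum>i=1..D. (D + 1 - i) * (m choose i)) = (\<Sum>i=1..D. \<Sum>j=1..i. m choose j)"
proof (induction D)
  case (Suc D)
  have "(\<Sum>i=1..D. (Suc D + 1 - i) * (m choose i))
      = (\<Sum>i=1..D. (D + 1 - i) * (m choose i) + (m choose i))"
    by (intro sum.cong) (auto simp: Suc_diff_le)
  then show ?case
    using Suc by (simp add: sum.distrib)
qed simp

text \<open>Double counting of pairs of a vertex and a threshold \<open>i\<close> in
  \<open>{1..D}\<close> that its value does not exceed. Truncated subtraction gives 0 exactly when
  no threshold qualifies.\<close>

lemma sum_truncated_diff:
  fixes f :: "'v \<Rightarrow> nat"
  assumes "finite V" "\<And>v. v \<in> V \<Longrightarrow> 1 \<le> f v"
  shows "(\<Sum>v\<in>V. D + 1 - f v) = (\<Sum>i=1..D. card {v \<in> V. f v \<le> i})"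
proof -
  have "D + 1 - f v = (\<Sum>i=1..D. of_bool (f v \<le> i))" if "v \<in> V" for v
  proof -
    \<comment> \<open>A value 0 would break the count: only \<open>D\<close> thresholds would
      qualify, while the difference would be \<open>D + 1\<close>.\<close>
    have "{1..D} \<inter> {i. f v \<le> i} = {f v..D}"
      using assms(2)[OF that] by auto
    then show ?thesis
      by (simp add: of_bool_def sum.If_cases)
  qed
  then have "(\<Sum>v\<in>V. D + 1 - f v) = (\<Sum>v\<in>V. \<Sum>i=1..D. of_bool (f v \<le> i))"
    by simp
  also have "\<dots> = (\<Sum>i=1..D. \<Sum>v\<in>V. of_bool (f v \<le> i))"
    by (rule sum.swap)
  also have "\<dots> = (\<Sum>i=1..D. card {v \<in> V. f v \<le> i})"
    using assms(1) by (simp add: of_bool_def sum.If_cases Int_def)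
  finally show ?thesis .
qed

lemma card_nonempty_subsets_le:
  assumes "finite A"
  shows "card {S. S \<subseteq> A \<and> S \<noteq> {} \<and> card S \<le> i} = (\<Sum>j=1..i. card A choose j)"
proof -
  have "{S. S \<subseteq> A \<and> S \<noteq> {} \<and> card S \<le> i} = (\<Union>j\<in>{1..i}. {S. S \<subseteq> A \<and> card S = j})"
    using assms by (auto simp: Suc_le_eq card_gt_0_iff dest: finite_subset)
  also have "card \<dots> = (\<Sum>j=1..i. card {S. S \<subseteq> A \<and> card S = j})"
    using assms by (intro card_UN_disjoint) auto
  finally show ?thesis
    using assms by (simp add: n_subsets)
qed

section \<open>Degree sums, existence of colorings and positive degrees\<close>

text \<open>The fibre over an edge consists of an arc and its reverse: symmetry provides the
  reverse, looplessness makes it different, and the absence of parallel arcs excludes further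
  members.\<close>

lemma (in graph) card_arcs_eq: "card (arcs G) = 2 * card (edges G)"
proof -
  have "card {e \<in> arcs G. {tail G e, head G e} = x} = 2" if x: "x \<in> edges G" for x
  proof -
    obtain e where e: "e \<in> arcs G" "x = {tail G e, head G e}"
      using x by (auto simp: edges_def)
    obtain e' where e': "e' \<in> arcs G" "tail G e = head G e'" "head G e = tail G e'"
      using sym_arcs e(1) unfolding symmetric_conv by blast
    have "a = e \<or> a = e'" if "a \<in> arcs G" "{tail G a, head G a} = x" for a
      using that e e' no_multi_arcs[of a e] no_multi_arcs[of a e']
      by (auto simp: arc_to_ends_def doubleton_eq_iff)
    then have "{e \<in> arcs G. {tail G e, head G e} = x} = {e, e'}"
      using e e' by auto
    moreover have "e \<noteq> e'"
      using e' no_loops by metis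
    ultimately show ?thesis
      by simp
  qed
  moreover have "card (arcs G) = (\<Sum>x\<in>edges G. card {e \<in> arcs G. {tail G e, head G e} = x})"
    using sum.image_gen[of "arcs G" "\<lambda>_. 1::nat" "\<lambda>e. {tail G e, head G e}"]
    by (simp add: edges_def)
  ultimately show ?thesis
    by simp
qed

lemma (in fin_digraph) sum_out_degree: "(\<Sum>v\<in>verts G. out_degree G v) = card (arcs G)"
proof -
  have "(\<Sum>v\<in>verts G. card {e \<in> arcs G. tail G e = v}) = card (arcs G)"
    using sum.group[of "arcs G" "verts G" "tail G" "\<lambda>_. 1::nat"] by (simp add: image_subset_iff)
  then show ?thesis
    by (simp add: out_degree_def out_arcs_def)
qed

lemma (in graph) average_degree_mult:
  "average_degree G * real (card (verts G)) = real (\<Sum>v\<in>verts G. out_degree G v)"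
proof (cases "verts G = {}")
  case False
  then show ?thesis
    by (simp add: average_degree_def sum_out_degree card_arcs_eq)
qed simp

lemma (in graph) ex_neighbor_locating_coloring:
  "\<exists>f. neighbor_locating_coloring G (nl_chromatic_number G) f"
proof -
  obtain h where "bij_betw h (verts G) {1..card (verts G)}"
    using finite_same_card_bij[OF finite_verts, of "{1..card (verts G)}"]
    by auto
  then have "neighbor_locating_coloring G (card (verts G)) h"
    using adj_not_same
    by (auto simp: neighbor_locating_coloring_def proper_coloring_def bij_betw_def inj_on_def)
  then show ?thesis
    unfolding nl_chromatic_number_def by (intro LeastI_ex[of "\<lambda>k. \<exists>f. neighbor_locating_coloring G k f"]) blast
qed

text \<open>The first arc of a walk to some other vertex leaves \<open>v\<close>.\<close>

lemma (in graph) one_le_out_degree: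
  assumes "connected G" "2 \<le> card (verts G)" "v \<in> verts G"
  shows "1 \<le> out_degree G v"
proof -
  obtain w where w: "w \<in> verts G" "w \<noteq> v"
    using assms(2,3) by (metis card_le_Suc0_iff_eq finite_verts not_less_eq_eq numeral_2_eq_2)
  have "v \<rightarrow>\<^sup>*\<^bsub>G\<^esub> w"
    using assms(1,3) w symmetric_connected_imp_strongly_connected[OF sym_arcs] by auto
  then obtain u where "v \<rightarrow>\<^bsub>G\<^esub> u"
    using w by (cases rule: converse_reachable_cases) auto
  then have "out_arcs G v \<noteq> {}"
    by (auto simp: out_arcs_def)
  then show ?thesis
    by (simp add: out_degree_def card_gt_0_iff Suc_le_eq finite_out_arcs)
qed

section \<open>Counting vertices by their own color and their neighbors' colors\<close>

lemma (in graph) neighborhood_eq: "neighborhood G v = head G ` out_arcs G v"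
  by (auto simp: neighborhood_def arcs_ends_conv)

lemma (in graph) neighbor_colors:
  assumes "proper_coloring G k f" "v \<in> verts G" "1 \<le> out_degree G v"
  shows "f v \<in> {1..k}" "f ` neighborhood G v \<subseteq> {1..k} - {f v}"
    "f ` neighborhood G v \<noteq> {}" "card (f ` neighborhood G v) \<le> out_degree G v"
proof -
  show "f v \<in> {1..k}"
    using assms(1,2) by (auto simp: proper_coloring_def)
  show "f ` neighborhood G v \<subseteq> {1..k} - {f v}"
  proof (rule image_subsetI)
    fix w
    assume "w \<in> neighborhood G v"
    then have "w \<in> verts G" "v \<rightarrow>\<^bsub>G\<^esub> w"
      by (simp_all add: neighborhood_def)
    then have "f w \<in> {1..k}" "f v \<noteq> f w"
      using assms(1,2) unfolding proper_coloring_def by blast+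
    then show "f w \<in> {1..k} - {f v}"
      by simp
  qed
  show "f ` neighborhood G v \<noteq> {}"
    using assms(3) by (auto simp: neighborhood_eq out_degree_def)
  have "f ` neighborhood G v = (f \<circ> head G) ` out_arcs G v"
    by (auto simp: neighborhood_eq)
  then show "card (f ` neighborhood G v) \<le> out_degree G v"
    by (simp only: out_degree_def card_image_le finite_out_arcs)
qed

text \<open>A vertex of degree at most \<open>i\<close> sees at most \<open>i\<close> colors, so its
  pair lies in a set with \<open>k\<close> choices of color and nonempty subsets of size at most
  \<open>i\<close> of the other \<open>k - 1\<close> colors.\<close>

lemma (in graph) card_out_degree_le:
  assumes f: "neighbor_locating_coloring G k f"
    and pos: "\<And>v. v \<in> verts G \<Longrightarrow> 1 \<le> out_degree G v"
  shows "card {v \<in> verts G. out_degree G v \<le> i} \<le> k * (\<Sum>j=1..i. (k - 1) choose j)"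
proof -
  have proper: "proper_coloring G k f"
    using f by (simp add: neighbor_locating_coloring_def)
  let ?P = "\<lambda>c. {S. S \<subseteq> {1..k} - {c} \<and> S \<noteq> {} \<and> card S \<le> i}"
  have "inj_on (\<lambda>v. (f v, f ` neighborhood G v)) {v \<in> verts G. out_degree G v \<le> i}"
    using f unfolding neighbor_locating_coloring_def inj_on_def by blast
  moreover have "(\<lambda>v. (f v, f ` neighborhood G v)) ` {v \<in> verts G. out_degree G v \<le> i}
      \<subseteq> (SIGMA c:{1..k}. ?P c)"
  proof (rule image_subsetI)
    fix v
    assume "v \<in> {v \<in> verts G. out_degree G v \<le> i}"
    then have v: "v \<in> verts G" "out_degree G v \<le> i"
      by auto
    note nc = neighbor_colors[OF proper v(1) pos[OF v(1)]]
    have "card (f ` neighborhood G v) \<le> i"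
      using nc(4) v(2) by (rule le_trans)
    then show "(f v, f ` neighborhood G v) \<in> (SIGMA c:{1..k}. ?P c)"
      using nc(1-3) by (intro SigmaI CollectI conjI) simp_all
  qed
  moreover have "finite (SIGMA c:{1..k}. ?P c)"
    by (intro finite_SigmaI) (auto intro: finite_subset[of _ "Pow {1..k}"])
  ultimately have "card {v \<in> verts G. out_degree G v \<le> i} \<le> card (SIGMA c:{1..k}. ?P c)"
    by (rule card_inj_on_le)
  also have "\<dots> = (\<Sum>c=1..k. \<Sum>j=1..i. (k - 1) choose j)"
    by (subst card_SigmaI)
       (auto simp: card_nonempty_subsets_le intro: finite_subset[of _ "Pow {1..k}"])
  finally show ?thesis
    by simp
qed

lemma (in graph) card_verts_le_two_power:
  assumes f: "neighbor_locating_coloring G k f"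
    and pos: "\<And>v. v \<in> verts G \<Longrightarrow> 1 \<le> out_degree G v"
  shows "card (verts G) \<le> k * (2 ^ (k - 1) - 1)"
proof -
  have proper: "proper_coloring G k f"
    using f by (simp add: neighbor_locating_coloring_def)
  let ?P = "\<lambda>c. Pow ({1..k} - {c}) - {{}}"
  have "inj_on (\<lambda>v. (f v, f ` neighborhood G v)) (verts G)"
    using f unfolding neighbor_locating_coloring_def inj_on_def by blast
  moreover have "(\<lambda>v. (f v, f ` neighborhood G v)) ` verts G \<subseteq> (SIGMA c:{1..k}. ?P c)"
  proof (rule image_subsetI)
    fix v
    assume v: "v \<in> verts G"
    note nc = neighbor_colors[OF proper v pos[OF v]]
    show "(f v, f ` neighborhood G v) \<in> (SIGMA c:{1..k}. ?P c)"
      using nc(1-3) by (intro SigmaI DiffI PowI) simp_all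
  qed
  ultimately have "card (verts G) \<le> card (SIGMA c:{1..k}. ?P c)"
    by (rule card_inj_on_le) auto
  also have "\<dots> = (\<Sum>c=1..k. 2 ^ (k - 1) - 1)"
    by (subst card_SigmaI) (auto simp: card_Pow card_Diff_singleton)
  finally show ?thesis
    by simp
qed

section \<open>Upper bound on the order and its equality case\<close>

lemma (in graph) neighbor_locating_order_bound:
  assumes f: "neighbor_locating_coloring G k f"
    and pos: "\<And>v. v \<in> verts G \<Longrightarrow> 1 \<le> out_degree G v"
    and avg: "average_degree G \<le> real D"
  defines "B \<equiv> k * (\<Sum>i=1..D. (D + 1 - i) * ((k - 1) choose i))"
  shows "card (verts G) \<le> B"
    and "card (verts G) = B \<Longrightarrow> v \<in> verts G \<Longrightarrow> out_degree G v \<le> D + 1"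
    and "card (verts G) = B \<Longrightarrow> i \<in> {1..D} \<Longrightarrow>
      card {v \<in> verts G. out_degree G v = i} = k * ((k - 1) choose i)"
proof -
  let ?n = "card (verts G)" and ?deg = "out_degree G"
  let ?A = "\<lambda>i. card {v \<in> verts G. ?deg v \<le> i}"
  let ?S = "\<lambda>i. k * (\<Sum>j=1..i. (k - 1) choose j)"
  have A_le: "?A i \<le> ?S i" for i
    using card_out_degree_le[OF f pos] .
  have B: "B = (\<Sum>i=1..D. ?S i)"
    unfolding B_def sum_binomial_tail by (simp add: sum_distrib_left)
  have A_sum: "(\<Sum>v\<in>verts G. D + 1 - ?deg v) = (\<Sum>i=1..D. ?A i)"
    using pos by (intro sum_truncated_diff) auto
  have AB: "(\<Sum>i=1..D. ?A i) \<le> B"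
    unfolding B by (intro sum_mono A_le)
  have "real (\<Sum>v\<in>verts G. ?deg v) \<le> real (D * ?n)"
    unfolding average_degree_mult[symmetric] using avg by (simp add: mult_right_mono)
  then have deg_sum: "(\<Sum>v\<in>verts G. ?deg v) \<le> D * ?n"
    by linarith
  \<comment> \<open>Adding the degree back to the truncated difference gives a maximum, which keeps
    the whole comparison in the natural numbers.\<close>
  have max_sum: "(\<Sum>v\<in>verts G. max (D + 1) (?deg v)) = (\<Sum>i=1..D. ?A i) + (\<Sum>v\<in>verts G. ?deg v)"
    unfolding A_sum[symmetric] sum.distrib[symmetric] by (intro sum.cong) auto
  have const: "(\<Sum>v\<in>verts G. D + 1) = D * ?n + ?n"
    by simp
  have const_le: "(\<Sum>v\<in>verts G. D + 1) \<le> (\<Sum>v\<in>verts G. max (D + 1) (?deg v))"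
    by (intro sum_mono) simp
  have nA: "?n \<le> (\<Sum>i=1..D. ?A i)"
    using const const_le max_sum deg_sum by linarith
  then show "?n \<le> B"
    using AB by linarith
  show "?deg v \<le> D + 1" if "?n = B" "v \<in> verts G"
  proof -
    \<comment> \<open>With \<open>?n = B\<close> the maxima sum to at most
      \<open>B + D * ?n\<close>, which is the sum of the lower bounds \<open>D + 1\<close>. Equality
      of the sums then forces equality at every vertex.\<close>
    have "(\<Sum>v\<in>verts G. D + 1) = (\<Sum>v\<in>verts G. max (D + 1) (?deg v))"
      using const const_le max_sum deg_sum AB that(1) by linarith
    then have "D + 1 = max (D + 1) (?deg v)"
      by (rule sum_mono_inv[OF _ _ that(2)]) auto
    then show ?thesis
      by linarith
  qed
  show "card {v \<in> verts G. ?deg v = i} = k * ((k - 1) choose i)" if "?n = B" and i: "i \<in> {1..D}"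
  proof -
    have eq: "(\<Sum>i=1..D. ?A i) = (\<Sum>i=1..D. ?S i)"
      using nA AB B that(1) by linarith
    have A_eq: "?A j = ?S j" if "j \<in> {1..D}" for j
      using sum_mono_inv[OF eq A_le that] by simp
    obtain m where m: "i = Suc m"
      using i by (cases i) auto
    \<comment> \<open>Vertices of degree exactly \<open>i\<close> are counted by a difference of
      consecutive thresholds. For \<open>i = 1\<close> the lower one is 0, outside the range of
      \<open>A_eq\<close>; there both sides vanish because degrees are positive.\<close>
    have "?A m = ?S m"
    proof (cases m)
      case 0
      have no0: "{v \<in> verts G. ?deg v \<le> 0} = {}"
        using pos by force
      show ?thesis
        unfolding 0 no0 by simp
    next
      case (Suc l)
      then show ?thesis
        using i m by (intro A_eq) auto
    qed
    moreover have "?A i = ?A m + card {v \<in> verts G. ?deg v = i}"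
      unfolding m by (subst card_Un_disjoint[symmetric])
        (auto intro: arg_cong[where f = card] simp: le_Suc_eq)
    moreover have "?A i = ?S m + k * ((k - 1) choose i)"
      using A_eq[OF i] by (simp add: m distrib_left)
    ultimately show ?thesis
      by linarith
  qed
qed

section \<open>Asymptotic bound in the average degree\<close>

text \<open>Each of the \<open>D\<close> terms has weight at most \<open>D\<close> and binomial
  coefficient at most \<open>k ^ D\<close>.\<close>

lemma sum_binomial_le_power:
  assumes "1 \<le> k"
  shows "(\<Sum>i=1..D. (D + 1 - i) * ((k - 1) choose i)) \<le> D\<^sup>2 * k ^ D"
proof -
  have "(D + 1 - i) * ((k - 1) choose i) \<le> D * k ^ D" if "i \<in> {1..D}" for i
  proof (rule mult_le_mono)
    have "(k - 1) choose i \<le> (k - 1) ^ i"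
      by (cases "i \<le> k - 1") (auto simp: binomial_le_pow binomial_eq_0)
    also have "\<dots> \<le> k ^ i"
      by (intro power_mono) auto
    also have "\<dots> \<le> k ^ D"
      using that assms by (intro power_increasing) auto
    finally show "(k - 1) choose i \<le> k ^ D" .
  qed (use that in auto)
  then have "(\<Sum>i=1..D. (D + 1 - i) * ((k - 1) choose i)) \<le> (\<Sum>i=1..D. D * k ^ D)"
    by (rule sum_mono)
  then show ?thesis
    by (simp add: power2_eq_square mult.assoc)
qed

lemma (in graph) nl_chromatic_number_pos:
  assumes "verts G \<noteq> {}"
  shows "1 \<le> nl_chromatic_number G"
  using ex_neighbor_locating_coloring assms
  by (fastforce simp: neighbor_locating_coloring_def proper_coloring_def)

lemma (in graph) average_degree_singleton:
  assumes "card (verts G) = 1"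
  shows "average_degree G = 0"
proof -
  obtain v where "verts G = {v}"
    using assms by (auto simp: card_1_singleton_iff)
  then have "arcs G = {}"
    using no_loops tail_in_verts head_in_verts by (metis equals0I singletonD)
  then show ?thesis
    by (simp add: average_degree_def edges_def)
qed

lemma (in graph) order_quadratic_bound:
  assumes "connected G" "2 \<le> card (verts G)"
  defines "k \<equiv> nl_chromatic_number G" and "d \<equiv> average_degree G"
  shows "real (card (verts G)) \<le> 4 * (d\<^sup>2 * real k ^ (nat \<lceil>d\<rceil> + 1))"
proof -
  let ?n = "card (verts G)" and ?D = "nat \<lceil>d\<rceil>"
  have pos: "\<And>v. v \<in> verts G \<Longrightarrow> 1 \<le> out_degree G v"
    using one_le_out_degree assms by blast
  obtain f where f: "neighbor_locating_coloring G k f"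
    using ex_neighbor_locating_coloring unfolding k_def by blast
  have k1: "1 \<le> k"
    unfolding k_def using assms(2) by (intro nl_chromatic_number_pos) auto
  \<comment> \<open>Positive degrees make the average degree at least 1. Then its ceiling is below
    \<open>d + 1\<close>, hence at most \<open>2 * d\<close>; squaring this yields the constant
    4.\<close>
  have "(\<Sum>v\<in>verts G. 1) \<le> (\<Sum>v\<in>verts G. out_degree G v)"
    using pos by (rule sum_mono)
  then have "?n \<le> (\<Sum>v\<in>verts G. out_degree G v)"
    by simp
  then have "real ?n \<le> d * real ?n"
    unfolding d_def average_degree_mult of_nat_le_iff .
  then have d1: "1 \<le> d"
    using assms(2) by (simp add: mult_le_cancel_right1)
  have "?n \<le> k * (\<Sum>i=1..?D. (?D + 1 - i) * ((k - 1) choose i))"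
    by (rule neighbor_locating_order_bound(1)[OF f pos]) (auto simp: d_def real_nat_ceiling_ge)
  also have "\<dots> \<le> k * (?D\<^sup>2 * k ^ ?D)"
    by (intro mult_le_mono2 sum_binomial_le_power k1)
  finally have "real ?n \<le> real (k * (?D\<^sup>2 * k ^ ?D))"
    by (simp only: of_nat_le_iff)
  also have "\<dots> = (real ?D)\<^sup>2 * real k ^ (?D + 1)"
    by simp
  also have "\<dots> \<le> (2 * d)\<^sup>2 * real k ^ (?D + 1)"
  proof (intro mult_right_mono power_mono)
    show "real ?D \<le> 2 * d"
      using d1 by linarith
  qed auto
  finally show ?thesis
    by (simp add: power_mult_distrib)
qed

theorem theorem3:
  shows
    "(\<exists>C::real. \<forall>G :: ('a, 'b) pre_digraph. graph G \<longrightarrow> connected G \<longrightarrow> 2 \<le> card (verts G) \<longrightarrow>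
        (let n = card (verts G); k = nl_chromatic_number G; d = average_degree G
         in real n \<le> C * (d ^ 2 * real k ^ (nat \<lceil>d\<rceil> + 1)))) \<and>
     (\<forall>G :: ('a, 'b) pre_digraph. graph G \<longrightarrow> connected G \<longrightarrow>
        (let n = card (verts G); k = nl_chromatic_number G; D = nat \<lceil>average_degree G\<rceil>
         in (k \<le> D \<longrightarrow> n < D * k ^ (D - 1)) \<and>
            (2 \<le> n \<longrightarrow> k \<ge> D + 1 \<longrightarrow>
               n \<le> k * (\<Sum>i=1..D. (D + 1 - i) * ((k - 1) choose i))) \<and>
            (k \<ge> D + 1 \<longrightarrow> n = k * (\<Sum>i=1..D. (D + 1 - i) * ((k - 1) choose i)) \<longrightarrow>
               max_degree G \<le> D + 1 \<and>
               (\<forall>i\<in>{1..D}. card {v \<in> verts G. out_degree G v = i} = k * ((k - 1) choose i)))))"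
proof (intro conjI)
  show "\<exists>C::real. \<forall>G :: ('a, 'b) pre_digraph. graph G \<longrightarrow> connected G \<longrightarrow> 2 \<le> card (verts G) \<longrightarrow>
        (let n = card (verts G); k = nl_chromatic_number G; d = average_degree G
         in real n \<le> C * (d ^ 2 * real k ^ (nat \<lceil>d\<rceil> + 1)))"
    unfolding Let_def by (intro exI[of _ 4] allI impI) (rule graph.order_quadratic_bound)
next
  show "\<forall>G :: ('a, 'b) pre_digraph. graph G \<longrightarrow> connected G \<longrightarrow>
        (let n = card (verts G); k = nl_chromatic_number G; D = nat \<lceil>average_degree G\<rceil>
         in (k \<le> D \<longrightarrow> n < D * k ^ (D - 1)) \<and>
            (2 \<le> n \<longrightarrow> k \<ge> D + 1 \<longrightarrow>
               n \<le> k * (\<Sum>i=1..D. (D + 1 - i) * ((k - 1) choose i))) \<and>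
            (k \<ge> D + 1 \<longrightarrow> n = k * (\<Sum>i=1..D. (D + 1 - i) * ((k - 1) choose i)) \<longrightarrow>
               max_degree G \<le> D + 1 \<and>
               (\<forall>i\<in>{1..D}. card {v \<in> verts G. out_degree G v = i} = k * ((k - 1) choose i))))"
  proof (intro allI impI, unfold Let_def)
    fix G :: "('a, 'b) pre_digraph"
    assume "graph G" and con: "connected G"
    interpret graph G by fact
    define k where "k = nl_chromatic_number G"
    define D where "D = nat \<lceil>average_degree G\<rceil>"
    let ?n = "card (verts G)"
    let ?B = "k * (\<Sum>i=1..D. (D + 1 - i) * ((k - 1) choose i))"
    obtain f where f: "neighbor_locating_coloring G k f"
      using ex_neighbor_locating_coloring unfolding k_def by blast
    have ne: "verts G \<noteq> {}"
      using con by (simp add: connected_conv)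
    then have k1: "1 \<le> k"
      unfolding k_def by (rule nl_chromatic_number_pos)
    have avg: "average_degree G \<le> real D"
      by (simp add: D_def real_nat_ceiling_ge)
    have n1: "1 \<le> ?n"
      using ne by (simp add: Suc_le_eq card_gt_0_iff)
    \<comment> \<open>The one-vertex graph has no vertex of positive degree. With
      \<open>D = 0\<close>, it cannot satisfy \<open>k \<le> D\<close>, and \<open>?B = 0\<close>
      rules out equality with its order.\<close>
    have D0: "D = 0" if "\<not> 2 \<le> ?n"
      using that n1 average_degree_singleton by (simp add: D_def)
    have pos: "1 \<le> out_degree G v" if "2 \<le> ?n" "v \<in> verts G" for v
      using one_le_out_degree con that by blast
    have "?n < D * k ^ (D - 1)" if kD: "k \<le> D"
    proof -
      have "2 \<le> ?n"
        using kD k1 D0 by linarith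
      then have "?n \<le> k * (2 ^ (k - 1) - 1)"
        using card_verts_le_two_power[OF f] pos by blast
      also have "\<dots> < k * k ^ (k - 1)"
      proof -
        \<comment> \<open>For \<open>k = 1\<close> the base 2 exceeds \<open>k\<close>, but both
          exponents are 0.\<close>
        have "(2::nat) ^ (k - 1) \<le> k ^ (k - 1)"
          using k1 by (cases "k = 1") (auto intro!: power_mono)
        \<comment> \<open>Strictness comes from having excluded the empty set of neighbor
          colors.\<close>
        then have "2 ^ (k - 1) - 1 < k ^ (k - 1)"
          using k1 by (intro less_le_trans[OF diff_less]) auto
        then show ?thesis
          using k1 by simp
      qed
      also have "\<dots> \<le> D * k ^ (D - 1)"
        using kD k1 by (intro mult_le_mono power_increasing) auto
      finally show ?thesis .
    qed
    moreover have "?n \<le> ?B" if "2 \<le> ?n"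
      using neighbor_locating_order_bound(1)[OF f pos avg] that by blast
    moreover have "max_degree G \<le> D + 1 \<and>
        (\<forall>i\<in>{1..D}. card {v \<in> verts G. out_degree G v = i} = k * ((k - 1) choose i))"
      if eq: "?n = ?B"
    proof -
      have n2: "2 \<le> ?n"
      proof (rule ccontr)
        assume "\<not> 2 \<le> ?n"
        then have "?B = 0"
          by (simp add: D0)
        with eq n1 show False
          by linarith
      qed
      have "\<And>v. v \<in> verts G \<Longrightarrow> out_degree G v \<le> D + 1"
        using neighbor_locating_order_bound(2)[OF f pos[OF n2] avg eq] .
      then have "max_degree G \<le> D + 1"
        using ne by (simp add: max_degree_def)
      then show ?thesis
        using neighbor_locating_order_bound(3)[OF f pos[OF n2] avg eq] by blast
    qed
    ultimately show "(nl_chromatic_number G \<le> nat \<lceil>average_degree G\<rceil> \<longrightarrow>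
          ?n < nat \<lceil>average_degree G\<rceil> * nl_chromatic_number G ^ (nat \<lceil>average_degree G\<rceil> - 1)) \<and>
        (2 \<le> ?n \<longrightarrow> nl_chromatic_number G \<ge> nat \<lceil>average_degree G\<rceil> + 1 \<longrightarrow>
          ?n \<le> nl_chromatic_number G * (\<Sum>i=1..nat \<lceil>average_degree G\<rceil>.
            (nat \<lceil>average_degree G\<rceil> + 1 - i) * ((nl_chromatic_number G - 1) choose i))) \<and>
        (nl_chromatic_number G \<ge> nat \<lceil>average_degree G\<rceil> + 1 \<longrightarrow>
          ?n = nl_chromatic_number G * (\<Sum>i=1..nat \<lceil>average_degree G\<rceil>.
            (nat \<lceil>average_degree G\<rceil> + 1 - i) * ((nl_chromatic_number G - 1) choose i)) \<longrightarrow>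
          max_degree G \<le> nat \<lceil>average_degree G\<rceil> + 1 \<and>
          (\<forall>i\<in>{1..nat \<lceil>average_degree G\<rceil>}. card {v \<in> verts G. out_degree G v = i} =
            nl_chromatic_number G * ((nl_chromatic_number G - 1) choose i)))"
      unfolding k_def[symmetric] D_def[symmetric] by blast
  qed
qed

end
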